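(* Let $\mathbb{X}$ be a finite-dimensional real polyhedral Banach space and $T:\mathbb{X}\to\mathbb{X}$ linear. The following are equivalent: (i) for some $k$ with $1\le k\le\dim\mathbb{X}$, $T$ preserves Birkhoff–James orthogonality at each $k$-smooth point of $S_{\mathbb{X}}$; (ii) $T$ preserves Birkhoff–James orthogonality at each point of some dense subset $U$ of $S_{\mathbb{X}}$; (iii) $T$ preserves $\rho$-orthogonality at each smooth point of $S_{\mathbb{X}}$; (iv) $T$ preserves $\rho_+$-orthogonality at each smooth point of $S_{\mathbb{X}}$; (v) $T$ preserves $\rho_-$-orthogonality at each smooth point of $S_{\mathbb{X}}$; (vi) $T$ is a scalar multiple of an isometry.
   Context: A finite-dimensional Banach space is polyhedral if its closed unit ball has finitely many extreme points. For non-zero $z$, $J(z)=\{f\in\mathbb{X}^*:\|f\|=1,\ f(z)=\|z\|\}$; $z$ is $k$-smooth if $\dim\operatorname{span}J(z)=k$, smooth if $k=1$. $u\perp_B v$ means $\|u+\lambda v\|\ge\|u\|$ for all real $\lambda$. Norm derivatives: $\rho'_\pm(u,v)=\|u\|\lim_{t\to0^\pm}\frac{\|u+tv\|-\|u\|}{t}$, $\rho'(u,v)=\frac12(\rho'_+(u,v)+\rho'_-(u,v))$; $u\perp_{\rho_\pm}v$ iff $\rho'_\pm(u,v)=0$, $u\perp_\rho v$ iff $\rho'(u,v)=0$. $T$ preserves a given orthogonality $\perp$ at $x$ if $x\perp w\Rightarrow Tx\perp Tw$ for all $w$. Scalar multiple of an isometry: there is $\lambda\ge0$ with $\|Tx\|=\lambda\|x\|$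 for all $x$. *)

theory Defs
  imports "HOL-Analysis.Analysis"
begin

definition fin_dim_space :: "'a::real_normed_vector itself \<Rightarrow> bool" where
  "fin_dim_space _ \<longleftrightarrow> (\<exists>B::'a set. finite B \<and> span B = UNIV)"

definition polyhedral_space :: "'a::real_normed_vector itself \<Rightarrow> bool" where
  "polyhedral_space _ \<longleftrightarrow> finite {x::'a. x extreme_point_of cball 0 1}"

definition supp_funcs :: "'a::real_normed_vector \<Rightarrow> ('a \<Rightarrow>\<^sub>L real) set" where
  "supp_funcs z = {f. norm f = 1 \<and> blinfun_apply f z = norm z}"

definition k_smooth :: "nat \<Rightarrow> 'a::real_normed_vector \<Rightarrow> bool" where
  "k_smooth k z \<longleftrightarrow> z \<noteq> 0 \<and> dim (span (supp_funcs z)) = k"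

abbreviation smooth_pt :: "'a::real_normed_vector \<Rightarrow> bool" where
  "smooth_pt z \<equiv> k_smooth 1 z"

definition bj_orth :: "'a::real_normed_vector \<Rightarrow> 'a \<Rightarrow> bool" where
  "bj_orth u v \<longleftrightarrow> (\<forall>c::real. norm (u + c *\<^sub>R v) \<ge> norm u)"

definition rho_plus :: "'a::real_normed_vector \<Rightarrow> 'a \<Rightarrow> real" where
  "rho_plus u v = norm u * Lim (at_right 0) (\<lambda>t. (norm (u + t *\<^sub>R v) - norm u) / t)"

definition rho_minus :: "'a::real_normed_vector \<Rightarrow> 'a \<Rightarrow> real" where
  "rho_minus u v = norm u * Lim (at_left 0) (\<lambda>t. (norm (u + t *\<^sub>R v) - norm u) / t)"

definition rho :: "'a::real_normed_vector \<Rightarrow> 'a \<Rightarrow> real" where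
  "rho u v = (rho_plus u v + rho_minus u v) / 2"

definition rho_plus_orth :: "'a::real_normed_vector \<Rightarrow> 'a \<Rightarrow> bool" where
  "rho_plus_orth u v \<longleftrightarrow> rho_plus u v = 0"

definition rho_minus_orth :: "'a::real_normed_vector \<Rightarrow> 'a \<Rightarrow> bool" where
  "rho_minus_orth u v \<longleftrightarrow> rho_minus u v = 0"

definition rho_orth :: "'a::real_normed_vector \<Rightarrow> 'a \<Rightarrow> bool" where
  "rho_orth u v \<longleftrightarrow> rho u v = 0"

definition preserves_at :: "('a \<Rightarrow> 'a \<Rightarrow> bool) \<Rightarrow> ('a \<Rightarrow> 'a) \<Rightarrow> 'a \<Rightarrow> bool" where
  "preserves_at orth T x \<longleftrightarrow> (\<forall>w. orth x w \<longrightarrow> orth (T x) (T w))"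

definition scalar_mult_isometry :: "('a::real_normed_vector \<Rightarrow> 'a) \<Rightarrow> bool" where
  "scalar_mult_isometry T \<longleftrightarrow> (\<exists>c::real\<ge>0. \<forall>x. norm (T x) = c * norm x)"

end

theory Submission
  imports Defs
begin

text \<open>
  Let \<open>f\<close> be the norm-one functional that cuts out a facet \<open>F\<close> of the unit ball. If \<open>T\<close> preserves
  Birkhoff--James orthogonality at \<open>x \<in> F\<close>, then splitting \<open>y = f(y) x + w\<close> with \<open>f(w) = 0\<close>
  gives \<open>norm (T y) \<ge> \<bar>f(y)\<bar> norm (T x)\<close> for all \<open>y\<close>. Hence \<open>norm \<circ> T\<close> takes a single value \<open>c\<close>
  at all such points of \<open>F\<close> and is at least \<open>c\<close> on \<open>F\<close>; if these points have \<open>F\<close> as their closed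
  convex hull, convexity gives \<open>norm \<circ> T = c\<close> on \<open>F\<close>. The hypothesis on the hull holds for a dense
  subset of the sphere, because facets have interior in the sphere, and for the \<open>k\<close>-smooth points,
  because these are the relative interior points of the faces of dimension \<open>n - k\<close>, and each vertex
  of \<open>F\<close> lies on such a face of \<open>F\<close>. There are finitely many facets, so the continuous function
  \<open>norm (T x) / norm x\<close> has finite range on every segment that misses the origin and is constant.
  At a smooth point of a polyhedral space the norm is locally a single functional, so there all the
  orthogonality notions agree; at the possibly non-smooth image point, each of
  \<open>\<rho>\<close>, \<open>\<rho>\<^sub>+\<close>, \<open>\<rho>\<^sub>-\<close>-orthogonality still implies Birkhoff--James orthogonality since \<open>\<rho>\<^sub>- \<le> \<rho>\<^sub>+\<close>.
\<close>

section \<open>Facets of polytopes with the origin in the interior\<close>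

text \<open>The points of the polar of \<open>P\<close> that attain their bound 1 at
  \<open>x\<close>. For the unit ball in coordinates they represent J(x), see
  \<open>supp_funcs_eq_dual_image\<close>.\<close>

definition supporting_vectors :: "'a::real_inner set \<Rightarrow> 'a \<Rightarrow> 'a set" where
  "supporting_vectors P x = {a. (\<forall>y\<in>P. a \<bullet> y \<le> 1) \<and> a \<bullet> x = 1}"

text \<open>Because the origin is interior, the right-hand side of each bounding half-space is
  positive and can be scaled to 1.\<close>

lemma polytope_finite_normalized_halfspaces:
  fixes P :: "'a::euclidean_space set"
  assumes "polytope P" "0 \<in> interior P"
  obtains C where "finite C" "P = {x. \<forall>a\<in>C. a \<bullet> x \<le> 1}"
proof -
  obtain H where H: "finite H" "P = \<Inter>H"
      and hs: "\<forall>h\<in>H. \<exists>a b. a \<noteq> 0 \<and> h = {x. a \<bullet> x \<le> b}"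
    using polytope_imp_polyhedron[OF assms(1)] unfolding polyhedron_def by blast
  have "\<exists>a. h = {x. a \<bullet> x \<le> 1}" if "h \<in> H" for h
  proof -
    obtain a b where ab: "a \<noteq> 0" "h = {x. a \<bullet> x \<le> b}"
      using hs \<open>h \<in> H\<close> by blast
    have "interior P \<subseteq> interior h"
      using H(2) \<open>h \<in> H\<close> by (intro interior_mono) blast
    then have "b > 0"
      using assms(2) ab by auto
    then have "h = {x. (a /\<^sub>R b) \<bullet> x \<le> 1}"
      using ab(2) by (auto simp: field_simps)
    then show ?thesis by blast
  qed
  then obtain v where v: "\<And>h. h \<in> H \<Longrightarrow> h = {x. v h \<bullet> x \<le> 1}"
    by metis
  have "P = {x. \<forall>a\<in>v ` H. a \<bullet> x \<le> 1}"
    using H(2) v by blast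
  then show thesis
    using H(1) that[of "v ` H"] by blast
qed

lemma facet_supporting_vector:
  fixes P :: "'a::euclidean_space set"
  assumes "polytope P" "0 \<in> interior P" "F facet_of P"
  obtains a where "\<forall>y\<in>P. a \<bullet> y \<le> 1" "F = {x\<in>P. a \<bullet> x = 1}"
proof -
  obtain a b where ab: "a \<noteq> 0" "P \<subseteq> {x. a \<bullet> x \<le> b}" "F = P \<inter> {x. a \<bullet> x = b}"
    using facet_of_polyhedron polytope_imp_polyhedron assms(1,3) by metis
  have "interior P \<subseteq> interior {x. a \<bullet> x \<le> b}"
    using ab(2) by (rule interior_mono)
  then have "b > 0"
    using assms(2) ab(1) by auto
  then have "\<forall>y\<in>P. (a /\<^sub>R b) \<bullet> y \<le> 1" "F = {x\<in>P. (a /\<^sub>R b) \<bullet> x = 1}"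
    using ab by (auto simp: field_simps)
  then show thesis
    by (rule that)
qed

lemma frontier_eq_Union_facets:
  fixes P :: "'a::euclidean_space set"
  assumes "polytope P" "interior P \<noteq> {}"
  shows "frontier P = \<Union>{F. F facet_of P}"
proof -
  have "frontier P = P - rel_interior P"
    using assms polytope_imp_closed rel_interior_nonempty_interior
    by (metis closure_closed frontier_def)
  then show ?thesis
    using rel_boundary_of_polyhedron polytope_imp_polyhedron assms(1) by metis
qed

text \<open>A relative interior point of \<open>F\<close> lies on no other facet. The other facets
  form a closed set, so points of \<open>U\<close> close to it must lie on \<open>F\<close>; and the
  relative interior is dense in \<open>F\<close>.\<close>

lemma facet_subset_closure_dense:
  fixes P :: "'a::euclidean_space set"
  assumes P: "polytope P" "interior P \<noteq> {}" and F: "F facet_of P"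
    and U: "U \<subseteq> frontier P" "frontier P \<subseteq> closure U"
  shows "F \<subseteq> closure (U \<inter> F)"
proof -
  have fr: "frontier P = \<Union>{F. F facet_of P}"
    by (rule frontier_eq_Union_facets[OF P])
  have "x \<in> closure (U \<inter> F)" if x: "x \<in> rel_interior F" for x
  proof -
    define K where "K = \<Union>({G. G facet_of P} - {F})"
    have "closed G" if "G facet_of P" for G
      using that P(1) face_of_polytope_polytope facet_of_imp_face_of polytope_imp_closed by blast
    then have "closed K"
      unfolding K_def using finite_polytope_facets[OF P(1)] by (intro closed_Union) auto
    have "x \<notin> K"
    proof
      assume "x \<in> K"
      then obtain G where G: "G facet_of P" "G \<noteq> F" "x \<in> G"
        unfolding K_def by blast
      \<comment> \<open>A face of \<open>P\<close> that meets the relative interior of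
        \<open>F\<close> contains \<open>F\<close>. Then \<open>F\<close> would be a face of
        \<open>G\<close> different from \<open>G\<close>, hence of smaller dimension, while all
        facets have the same dimension.\<close>
      have "F \<subseteq> G"
        using subset_of_face_of[of G P F] G F x by (auto simp: facet_of_imp_face_of facet_of_imp_subset)
      then have "F face_of G"
        using F G face_of_subset facet_of_imp_face_of facet_of_imp_subset by metis
      then have "aff_dim F < aff_dim G"
        using face_of_aff_dim_lt G F face_of_imp_convex facet_of_imp_face_of by metis
      then show False
        using F G by (simp add: facet_of_def)
    qed
    show ?thesis
      unfolding closure_iff_nhds_not_empty
    proof (intro allI impI)
      fix A V assume A: "V \<subseteq> A" "open V" "x \<in> V"
      have "x \<in> closure U"
        using x F U(2) fr rel_interior_subset by blast
      moreover have "open (V - K)" "x \<in> V - K"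
        using A \<open>closed K\<close> \<open>x \<notin> K\<close> by auto
      ultimately obtain u where u: "u \<in> U" "u \<in> V - K"
        by (metis closure_iff_nhds_not_empty disjoint_iff subset_refl)
      then have "u \<in> F"
        using U(1) fr unfolding K_def by blast
      then show "(U \<inter> F) \<inter> A \<noteq> {}"
        using u A by blast
    qed
  qed
  then have "closure (rel_interior F) \<subseteq> closure (U \<inter> F)"
    by (intro closure_minimal) auto
  moreover have "convex F"
    using F face_of_imp_convex facet_of_imp_face_of by blast
  ultimately show ?thesis
    using convex_closure_rel_interior closure_subset by blast
qed

text \<open>Descent through facets: as long as the dimension of \<open>Q\<close> exceeds
  \<open>m\<close>, the vertex is a proper face and so lies on a facet, where it is still extreme
  and the dimension has dropped by one.\<close>

lemma polytope_face_through_extreme_point: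
  fixes Q :: "'a::euclidean_space set"
  assumes "polytope Q" "v extreme_point_of Q" "int m \<le> aff_dim Q"
  shows "\<exists>G. G face_of Q \<and> v \<in> G \<and> aff_dim G = int m"
  using assms
proof (induction "nat (aff_dim Q) - m" arbitrary: Q)
  case 0
  then have "aff_dim Q = int m" by simp
  then show ?case
    using "0.prems" extreme_point_of_def face_of_refl polytope_imp_convex by blast
next
  case (Suc d)
  then have "aff_dim Q > int m" by linarith
  then have "{v} \<noteq> Q"
    using aff_dim_sing[of v] by (metis not_less of_nat_0_le_iff)
  moreover have "{v} face_of Q"
    using Suc.prems(2) face_of_singleton by blast
  ultimately obtain F where F: "F facet_of Q" "{v} \<subseteq> F"
    using face_of_polyhedron_subset_facet[of Q "{v}"] Suc.prems(1) polytope_imp_polyhedron by blast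
  have face: "F face_of Q" and dF: "aff_dim F = aff_dim Q - 1"
    using F by (auto simp: facet_of_def)
  have "polytope F"
    using face Suc.prems(1) face_of_polytope_polytope by blast
  moreover have "v extreme_point_of F"
    using F face Suc.prems(2) extreme_point_of_face by blast
  moreover have "d = nat (aff_dim F) - m" "int m \<le> aff_dim F"
    using Suc.hyps(2) dF \<open>aff_dim Q > int m\<close> by linarith+
  ultimately obtain G where "G face_of F" "v \<in> G" "aff_dim G = int m"
    using Suc.hyps(1) by blast
  then show ?case
    using face face_of_trans by blast
qed

text \<open>The annihilator \<open>W\<close> of the supporting vectors at \<open>x\<close> has the
  dimension of \<open>G\<close>, since it is spanned by the directions of \<open>G\<close>; the
  formula is then the dimension count for an orthogonal complement.\<close>

lemma dim_supporting_vectors: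
  fixes P :: "'a::euclidean_space set"
  assumes P: "polytope P" "0 \<in> interior P" and G: "G face_of P" and x: "x \<in> rel_interior G"
  shows "int (dim (supporting_vectors P x)) + aff_dim G = int (DIM('a))"
proof -
  let ?A = "supporting_vectors P x"
  define W where "W = {w. \<forall>a\<in>?A. a \<bullet> w = 0}"
  have xG: "x \<in> G" and GP: "G \<subseteq> P"
    using x rel_interior_subset G face_of_imp_subset by blast+
  have "W = {y \<in> UNIV. \<forall>a\<in>span ?A. orthogonal a y}"
    unfolding W_def orthogonal_def
    by (auto intro: span_base elim!: span_induct simp: subspace_def inner_add_left)
  then have dimW: "dim W + dim ?A = DIM('a)"
    using dim_subspace_orthogonal_to_vectors[of "span ?A" UNIV] by simp
  have "W \<subseteq> span ((\<lambda>y. y - x) ` G)"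
  proof
    fix w assume w: "w \<in> W"
    obtain C where C: "finite C" "P = {x. \<forall>a\<in>C. a \<bullet> x \<le> 1}"
      using polytope_finite_normalized_halfspaces[OF P] .
    \<comment> \<open>A step from \<open>x\<close> in a direction of \<open>W\<close> keeps tight
      the constraints that are tight at \<open>x\<close>; the remaining ones are finitely many and
      strict at \<open>x\<close>, so they survive a small step.\<close>
    have ev: "\<forall>\<^sub>F t in at_right 0. x + t *\<^sub>R v \<in> P" if v: "v \<in> W" for v
    proof -
      have "\<forall>\<^sub>F t in at_right 0. a \<bullet> (x + t *\<^sub>R v) \<le> 1" if a: "a \<in> C" for a
      proof (cases "a \<bullet> x = 1")
        case True
        then have "a \<in> ?A"
          using C a by (auto simp: supporting_vectors_def)
        then show ?thesis
          using True v by (simp add: W_def inner_add_right)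
      next
        case False
        then have "a \<bullet> x < 1"
          using C a xG GP by force
        moreover have "((\<lambda>t. a \<bullet> (x + t *\<^sub>R v)) \<longlongrightarrow> a \<bullet> (x + 0 *\<^sub>R v)) (at_right 0)"
          by (intro tendsto_intros)
        ultimately have "\<forall>\<^sub>F t in at_right 0. a \<bullet> (x + t *\<^sub>R v) < 1"
          by (intro order_tendstoD(2)) auto
        then show ?thesis
          by eventually_elim simp
      qed
      then show ?thesis
        using C by (simp add: eventually_ball_finite)
    qed
    have "- w \<in> W"
      using w by (simp add: W_def)
    then have "\<forall>\<^sub>F t in at_right 0. t > 0 \<and> x + t *\<^sub>R w \<in> P \<and> x + t *\<^sub>R (- w) \<in> P"
      using ev[OF w] ev[of "- w"] by (simp add: eventually_conj_iff eventually_at_right_less)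
    then obtain t :: real where t: "t > 0" "x + t *\<^sub>R w \<in> P" "x + t *\<^sub>R (- w) \<in> P"
      using eventually_happens'[OF trivial_limit_at_right_real] by blast
    \<comment> \<open>For non-zero \<open>w\<close>, \<open>x\<close> is the midpoint of two
      distinct points of \<open>P\<close>; as \<open>x\<close> lies in the face \<open>G\<close>, so
      do they.\<close>
    have "x + t *\<^sub>R w \<in> G"
    proof (cases "w = 0")
      case False
      have "x = midpoint (x + t *\<^sub>R w) (x + t *\<^sub>R (- w))"
        by (simp add: midpoint_def flip: scaleR_2)
      moreover have "x + t *\<^sub>R w \<noteq> x + t *\<^sub>R (- w)"
        using False t by (simp add: eq_neg_iff_add_eq_0 flip: scaleR_2)
      ultimately have "x \<in> open_segment (x + t *\<^sub>R w) (x + t *\<^sub>R (- w))"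
        using midpoint_in_open_segment by metis
      then show ?thesis
        using face_ofD[OF G] t xG by blast
    qed (use xG in simp)
    then have "(x + t *\<^sub>R w) - x \<in> span ((\<lambda>y. y - x) ` G)"
      by (intro span_base) blast
    then have "t *\<^sub>R w \<in> span ((\<lambda>y. y - x) ` G)"
      by simp
    then have "(1/t) *\<^sub>R (t *\<^sub>R w) \<in> span ((\<lambda>y. y - x) ` G)"
      by (rule span_scale)
    then show "w \<in> span ((\<lambda>y. y - x) ` G)"
      using t by simp
  qed
  moreover have "(\<lambda>y. y - x) ` G \<subseteq> W"
  proof (clarsimp simp: W_def)
    fix y a assume y: "y \<in> G" and a: "a \<in> ?A"
    have "a \<bullet> y \<le> 1" "a \<bullet> x = 1"
      using a y GP by (auto simp: supporting_vectors_def)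
    moreover have "a \<bullet> y \<ge> 1"
    proof -
      \<comment> \<open>From \<open>y\<close> one can move inside \<open>G\<close> through
        \<open>x\<close> and a little beyond. An affine function that is 1 at \<open>x\<close> and
        at most 1 beyond it is at least 1 at \<open>y\<close>.\<close>
      obtain e where e: "e > 1" "(1 - e) *\<^sub>R y + e *\<^sub>R x \<in> G"
        using convex_rel_interior_iff[of G x] face_of_imp_convex[OF G] x y by blast
      then have "a \<bullet> ((1 - e) *\<^sub>R y + e *\<^sub>R x) \<le> 1"
        using a GP by (auto simp: supporting_vectors_def)
      then have "(1 - e) * (a \<bullet> y) + e \<le> 1"
        using \<open>a \<bullet> x = 1\<close> by (simp add: inner_add_right)
      then have "(e - 1) * 1 \<le> (e - 1) * (a \<bullet> y)"
        by (simp add: algebra_simps)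
      then show ?thesis
        using e by (simp add: mult_le_cancel_left_pos)
    qed
    ultimately show "a \<bullet> (y - x) = 0"
      by (simp add: inner_diff_right)
  qed
  ultimately have "dim W = dim ((\<lambda>y. y - x) ` G)"
    by (metis dim_span dim_subset antisym)
  moreover have "aff_dim G = int (dim ((\<lambda>y. y - x) ` G))"
    using xG hull_inc by (intro aff_dim_eq_dim_subtract) fast
  ultimately show ?thesis
    using dimW by linarith
qed

text \<open>By Krein-Milman it suffices to reach the vertices of \<open>F\<close>. By
  \<open>dim_supporting_vectors\<close>, all relative interior points of a face of dimension
  \<open>DIM('a) - k\<close> through such a vertex qualify, and the vertex is a limit of
  them.\<close>

lemma facet_subset_closure_hull_k_smooth:
  fixes P :: "'a::euclidean_space set"
  assumes P: "polytope P" "0 \<in> interior P" and F: "F facet_of P"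
    and k: "1 \<le> k" "k \<le> DIM('a)"
  shows "F \<subseteq> closure (convex hull {x\<in>F. dim (supporting_vectors P x) = k})"
proof -
  let ?D = "{x\<in>F. dim (supporting_vectors P x) = k}"
  have face: "F face_of P"
    using F by (rule facet_of_imp_face_of)
  have pF: "polytope F"
    using face P(1) face_of_polytope_polytope by blast
  have "aff_dim P = int (DIM('a))"
    using P(2) by (intro aff_dim_nonempty_interior) auto
  then have dF: "aff_dim F = int (DIM('a)) - 1"
    using F by (simp add: facet_of_def)
  have "v \<in> closure ?D" if v: "v extreme_point_of F" for v
  proof -
    \<comment> \<open>\<open>F\<close> has dimension \<open>DIM('a) - 1\<close>, so \<open>k\<close>
      being at least 1 is exactly what leaves room in \<open>F\<close> for a face of this
      dimension.\<close>
    obtain G where G: "G face_of F" "v \<in> G" "aff_dim G = int (DIM('a) - k)"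
      using polytope_face_through_extreme_point[OF pF v, of "DIM('a) - k"] dF k by auto
    have "x \<in> ?D" if x: "x \<in> rel_interior G" for x
    proof -
      have xF: "x \<in> F"
        using x G rel_interior_subset face_of_imp_subset by blast
      have "G face_of P"
        using G(1) face by (rule face_of_trans)
      then have "int (dim (supporting_vectors P x)) + aff_dim G = int (DIM('a))"
        using dim_supporting_vectors[OF P] x by blast
      then show ?thesis
        using G(3) k xF by simp
    qed
    then have "closure (rel_interior G) \<subseteq> closure ?D"
      by (intro closure_mono) blast
    moreover have "v \<in> closure (rel_interior G)"
      using G convex_closure_rel_interior face_of_imp_convex closure_subset by blast
    ultimately show ?thesis by blast
  qed
  then have "convex hull {v. v extreme_point_of F} \<subseteq> closure (convex hull ?D)"
    by (intro hull_minimal) (auto intro: closure_mono[OF hull_subset, THEN subsetD])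
  then show ?thesis
    using Krein_Milman_Minkowski[of F] pF polytope_imp_compact polytope_imp_convex by blast
qed

section \<open>Euclidean coordinates\<close>

text \<open>
  A finite index type whose cardinality is the dimension of the space, so that
  \<open>real ^ 'a dim_index\<close> is a Euclidean space isomorphic to \<open>'a\<close>; the polytope library applies only to
  Euclidean space types. The maximum with 1 makes the type inhabited in every case.
\<close>

typedef (overloaded) ('a::real_normed_vector) dim_index = "{..<max 1 (dim (UNIV :: 'a set))}"
  by (rule exI[of _ 0]) simp

instance dim_index :: (real_normed_vector) finite
proof
  show "finite (UNIV :: 'a dim_index set)"
    using type_definition.univ[OF type_definition_dim_index] by (metis finite_imageI finite_lessThan)
qed

lemma card_dim_index: "CARD('a::real_normed_vector dim_index) = max 1 (dim (UNIV :: 'a set))"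
  using type_definition.card[OF type_definition_dim_index] by (metis card_lessThan)

text \<open>The target carries an arbitrary norm. On the compact Euclidean unit sphere
  \<open>norm (h x)\<close> attains a minimum, positive because \<open>h\<close> is injective; its
  reciprocal bounds \<open>g\<close>.\<close>

lemma bounded_linear_inverse_euclidean:
  fixes h :: "'e::euclidean_space \<Rightarrow> 'a::real_normed_vector"
  assumes "linear h" "linear g" "\<And>x. g (h x) = x" "\<And>y. h (g y) = y"
  shows "bounded_linear g"
proof -
  have "continuous_on (sphere 0 1) (\<lambda>x. norm (h x))"
    using assms(1) by (intro continuous_intros linear_continuous_on) (simp add: linear_conv_bounded_linear)
  moreover have "sphere (0::'e) 1 \<noteq> {}"
    by simp
  ultimately obtain u where u: "u \<in> sphere 0 1" "\<And>x. x \<in> sphere 0 1 \<Longrightarrow> norm (h u) \<le> norm (h x)"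
    using continuous_attains_inf[OF compact_sphere] by metis
  have "h u \<noteq> 0"
  proof
    assume "h u = 0"
    then have "u = 0"
      using assms(3)[of u] linear_0[OF assms(2)] by simp
    then show False
      using u(1) by simp
  qed
  have "norm (g y) \<le> norm y * (1 / norm (h u))" for y
  proof (cases "g y = 0")
    case False
    let ?x = "g y /\<^sub>R norm (g y)"
    have "norm (h u) \<le> norm (h ?x)"
      using False by (intro u(2)) simp
    also have "h ?x = y /\<^sub>R norm (g y)"
      using linear_scale[OF assms(1)] assms(4) by simp
    finally show ?thesis
      using False \<open>h u \<noteq> 0\<close> by (simp add: field_simps)
  qed simp
  then show ?thesis
    using assms(2) by (intro bounded_linear_intro[where K = "1 / norm (h u)"])
      (auto simp: linear_add linear_scale)
qed

lemma finite_dimensional_euclidean_coordinates: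
  assumes "fin_dim_space TYPE('a::real_normed_vector)" "(UNIV :: 'a set) \<noteq> {0}"
  obtains h :: "real ^ ('a::real_normed_vector) dim_index \<Rightarrow> 'a" and g where
    "bounded_linear h" "bounded_linear g" "\<And>x. g (h x) = x" "\<And>y. h (g y) = y"
    "DIM(real ^ 'a dim_index) = dim (UNIV :: 'a set)"
proof -
  obtain S :: "'a set" where S: "finite S" "span S = UNIV"
    using assms(1) unfolding fin_dim_space_def by blast
  obtain C :: "'a set" where C: "C \<subseteq> UNIV" "independent C" "UNIV \<subseteq> span C" "card C = dim (UNIV :: 'a set)"
    by (rule real_vector.basis_exists)
  have "finite C"
    using independent_span_bound[OF S(1) C(2)] S(2) by simp
  have "C \<noteq> {}"
    using C(3) assms(2) by auto
  \<comment> \<open>Hence the maximum with 1 in \<open>dim_index\<close> is the dimension itself,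
    and bases of equal size give the isomorphism.\<close>
  then have "dim (UNIV :: 'a set) \<ge> 1"
    using C(4) \<open>finite C\<close> by (metis One_nat_def Suc_leI card_gt_0_iff)
  then have dim: "DIM(real ^ 'a dim_index) = dim (UNIV :: 'a set)"
    by (simp add: card_dim_index)
  have "\<exists>h :: real ^ 'a dim_index \<Rightarrow> 'a. linear h \<and> h ` Basis = C \<and> h ` UNIV = UNIV \<and> inj_on h UNIV"
    by (rule real_vector.finite_basis_to_basis_subspace_isomorphism)
      (use dim C \<open>finite C\<close> in \<open>auto simp: independent_Basis\<close>)
  then obtain h :: "real ^ 'a dim_index \<Rightarrow> 'a" where h: "linear h" "surj h" "inj h"
    by blast
  obtain g where g: "linear g" "g \<circ> h = id"
    using linear_injective_left_inverse[OF h(1,3)] by blast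
  have gh: "g (h x) = x" for x
    using g(2) by (metis comp_apply id_apply)
  have hg: "h (g y) = y" for y
    using h(2) gh by (metis surjD)
  have "bounded_linear h"
    using h(1) by (simp add: linear_conv_bounded_linear)
  then show thesis
    using that bounded_linear_inverse_euclidean[OF h(1) g(1) gh hg] gh hg dim by blast
qed

lemma extreme_point_of_linear_preimage:
  assumes "linear h" "linear g" "\<And>x. g (h x) = x" "\<And>y. h (g y) = y"
  shows "x extreme_point_of (h -` S) \<longleftrightarrow> h x extreme_point_of S"
proof -
  have seg: "x \<in> open_segment a b \<longleftrightarrow> h x \<in> open_segment (h a) (h b)" for a b
  proof -
    have inj: "inj h"
      using assms(3) by (metis injI)
    have "open_segment (h a) (h b) = h ` open_segment a b"
      using open_segment_linear_image[OF assms(1) inj] by simp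
    then show ?thesis
      using inj by (simp add: inj_image_mem_iff)
  qed
  show ?thesis
    unfolding extreme_point_of_def seg using assms(4) by (metis vimage_eq)
qed

section \<open>The unit ball as a polytope in coordinates\<close>

locale unit_ball_coordinates =
  fixes h :: "'e::euclidean_space \<Rightarrow> 'a::real_normed_vector" and g :: "'a \<Rightarrow> 'e"
  assumes bl_h: "bounded_linear h" and bl_g: "bounded_linear g"
    and gh [simp]: "g (h x) = x" and hg [simp]: "h (g y) = y"
    and polyhedral: "polyhedral_space TYPE('a)"
begin

definition P :: "'e set" where "P = h -` cball 0 1"

definition dual :: "'e \<Rightarrow> 'a \<Rightarrow>\<^sub>L real" where "dual a = Blinfun (\<lambda>y. a \<bullet> g y)"

lemma mem_P: "x \<in> P \<longleftrightarrow> norm (h x) \<le> 1"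
  by (simp add: P_def)

lemmas lin_h = bounded_linear.linear[OF bl_h]
lemmas lin_g = bounded_linear.linear[OF bl_g]

lemma cont_h: "continuous_on S h"
  by (rule linear_continuous_on[OF bl_h])

lemma cont_g: "continuous_on S g"
  by (rule linear_continuous_on[OF bl_g])

text \<open>\<open>P\<close> is compact and convex, hence the hull of its extreme points. The
  isomorphism \<open>h\<close> takes these to extreme points of the unit ball, of which there are
  finitely many.\<close>

lemma polytope_P: "polytope P"
proof -
  have "closed P"
    unfolding P_def using cont_h by (intro closed_vimage) auto
  moreover have "bounded P"
  proof -
    obtain K where K: "\<And>y. norm (g y) \<le> norm y * K" "K > 0"
      using bounded_linear.pos_bounded[OF bl_g] by blast
    have "norm x \<le> K" if "x \<in> P" for x
    proof -
      have "norm x \<le> norm (h x) * K"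
        using K(1)[of "h x"] by simp
      also have "\<dots> \<le> 1 * K"
        using that K(2) by (intro mult_right_mono) (auto simp: mem_P)
      finally show ?thesis by simp
    qed
    then show ?thesis
      by (auto simp: bounded_iff)
  qed
  moreover have "convex P"
    unfolding P_def by (intro convex_linear_vimage lin_h convex_cball)
  ultimately have "P = convex hull {x. x extreme_point_of P}"
    by (intro Krein_Milman_Minkowski) (auto simp: compact_eq_bounded_closed)
  moreover have "{x. x extreme_point_of P} \<subseteq> g ` {y. y extreme_point_of cball 0 1}"
    using extreme_point_of_linear_preimage[OF lin_h lin_g gh hg] unfolding P_def
    by (metis (no_types, lifting) gh image_eqI mem_Collect_eq subsetI)
  then have "finite {x. x extreme_point_of P}"
    using polyhedral finite_surj unfolding polyhedral_space_def by blast
  ultimately show ?thesis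
    unfolding polytope_def by blast
qed

lemma interior_P: "interior P = {x. norm (h x) < 1}"
proof
  have "open {x. norm (h x) < 1}"
    using cont_h by (intro open_Collect_less continuous_intros)
  then show "{x. norm (h x) < 1} \<subseteq> interior P"
    by (intro interior_maximal) (auto simp: mem_P)
  show "interior P \<subseteq> {x. norm (h x) < 1}"
  proof
    fix x assume x: "x \<in> interior P"
    \<comment> \<open>An interior point can be stretched by some factor \<open>t > 1\<close> without
      leaving \<open>P\<close>, so its norm is below 1.\<close>
    have "((\<lambda>t::real. t *\<^sub>R x) \<longlongrightarrow> 1 *\<^sub>R x) (at_right 1)"
      by (intro tendsto_intros)
    then have "\<forall>\<^sub>F t in at_right (1::real). t *\<^sub>R x \<in> interior P \<and> t > 1"
      using x topological_tendstoD[of _ _ _ "interior P"]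
      by (simp add: eventually_conj_iff eventually_at_right_less)
    then obtain t :: real where t: "t *\<^sub>R x \<in> interior P" "t > 1"
      using eventually_happens'[OF trivial_limit_at_right_real] by blast
    then have "t * norm (h x) \<le> 1"
      using interior_subset[of P] by (force simp: mem_P linear_scale[OF lin_h])
    then have "\<not> norm (h x) \<ge> 1"
      using t(2) by (smt (verit) mult_cancel_left1 mult_left_mono)
    then show "x \<in> {x. norm (h x) < 1}"
      by simp
  qed
qed

lemma zero_interior_P: "0 \<in> interior P"
  by (simp add: interior_P linear_0[OF lin_h])

lemma frontier_P: "frontier P = {x. norm (h x) = 1}"
  using polytope_imp_closed[OF polytope_P]
  by (auto simp: frontier_def interior_P mem_P)

lemma dual_apply [simp]: "blinfun_apply (dual a) y = a \<bullet> g y"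
  unfolding dual_def
  by (subst bounded_linear_Blinfun_apply)
    (auto intro: bounded_linear_compose[OF bounded_linear_inner_right bl_g])

lemma dual_le_norm:
  assumes "\<forall>y\<in>P. a \<bullet> y \<le> 1"
  shows "a \<bullet> g y \<le> norm y"
proof (cases "y = 0")
  case False
  have "g (y /\<^sub>R norm y) \<in> P"
    using False by (simp add: mem_P)
  then have "a \<bullet> g (y /\<^sub>R norm y) \<le> 1"
    using assms by blast
  then show ?thesis
    using False by (simp add: linear_scale[OF lin_g] field_simps)
qed (simp add: linear_0[OF lin_g])

text \<open>Being at most 1 on \<open>P\<close> amounts to dual norm at most 1, by homogeneity and
  the symmetry of the ball; the value 1 at \<open>x\<close> then makes the norm equal to 1.\<close>

lemma supp_funcs_eq_dual_image:
  assumes "norm (h x) = 1"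
  shows "supp_funcs (h x) = dual ` supporting_vectors P x"
proof
  show "dual ` supporting_vectors P x \<subseteq> supp_funcs (h x)"
  proof (clarsimp simp: supporting_vectors_def supp_funcs_def assms)
    fix a assume a: "\<forall>y\<in>P. a \<bullet> y \<le> 1" "a \<bullet> x = 1"
    have "\<bar>a \<bullet> g y\<bar> \<le> norm y" for y
      using dual_le_norm[OF a(1), of y] dual_le_norm[OF a(1), of "- y"]
      by (simp add: linear_neg[OF lin_g])
    then have "norm (dual a) \<le> 1"
      by (intro norm_blinfun_bound) auto
    moreover have "norm (dual a) \<ge> 1"
      using norm_blinfun[of "dual a" "h x"] a(2) assms by simp
    ultimately show "norm (dual a) = 1"
      by simp
  qed
  show "supp_funcs (h x) \<subseteq> dual ` supporting_vectors P x"
  proof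
    fix f assume f: "f \<in> supp_funcs (h x)"
    \<comment> \<open>The adjoint evaluated at 1 is the Riesz vector of \<open>f\<close> read in
      coordinates.\<close>
    define a where "a = adjoint (\<lambda>z. blinfun_apply f (h z)) 1"
    have "linear (\<lambda>z. blinfun_apply f (h z))"
      using linear_compose[OF lin_h bounded_linear.linear[OF blinfun.bounded_linear_right[of f]]]
      by (simp add: o_def)
    then have a: "a \<bullet> z = blinfun_apply f (h z)" for z
      using adjoint_works[of "\<lambda>z. blinfun_apply f (h z)" z 1] by (simp add: a_def inner_commute)
    have "a \<bullet> y \<le> 1" if "y \<in> P" for y
      using norm_blinfun[of f "h y"] f that by (auto simp: a supp_funcs_def mem_P)
    then have "a \<in> supporting_vectors P x"
      using f assms by (auto simp: a supporting_vectors_def supp_funcs_def)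
    moreover have "f = dual a"
      by (rule blinfun_eqI) (simp add: a)
    ultimately show "f \<in> dual ` supporting_vectors P x"
      by blast
  qed
qed

lemma k_smooth_iff:
  assumes "norm (h x) = 1"
  shows "k_smooth k (h x) \<longleftrightarrow> dim (supporting_vectors P x) = k"
proof -
  have "linear dual"
    by (intro linearI blinfun_eqI) (auto simp: inner_add_left blinfun.add_left blinfun.scaleR_left)
  moreover have "inj dual"
  proof (rule injI)
    fix a b assume "dual a = dual b"
    then have "a \<bullet> g (h z) = b \<bullet> g (h z)" for z
      by (metis dual_apply)
    then show "a = b"
      using vector_eq_ldot[of a b] by (simp add: inner_commute)
  qed
  ultimately have "dim (dual ` supporting_vectors P x) = dim (supporting_vectors P x)"
    by (intro eucl.dim_image_eq) (auto intro: inj_on_subset)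
  then show ?thesis
    using assms unfolding k_smooth_def supp_funcs_eq_dual_image[OF assms] by auto
qed

text \<open>Collects what the later arguments need from the facets, stated in the normed space
  itself. The functionals are those cutting out the facets, and the closure statements are carried
  over by the continuous maps \<open>g\<close> and \<open>h\<close>.\<close>

lemma norming_functionals:
  assumes "(UNIV :: 'a set) \<noteq> {0}"
  obtains \<Phi> :: "('a \<Rightarrow>\<^sub>L real) set" where
    "finite \<Phi>"
    "\<And>f x. f \<in> \<Phi> \<Longrightarrow> blinfun_apply f x \<le> norm x"
    "\<And>x. \<exists>f\<in>\<Phi>. blinfun_apply f x = norm x"
    "\<And>f U. \<lbrakk>f \<in> \<Phi>; U \<subseteq> sphere 0 1; sphere 0 1 \<subseteq> closure U\<rbrakk> \<Longrightarrow>
       {x\<in>sphere 0 1. blinfun_apply f x = 1} \<subseteq> closure (U \<inter> {x\<in>sphere 0 1. blinfun_apply f x = 1})"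
    "\<And>f k. \<lbrakk>f \<in> \<Phi>; 1 \<le> k; k \<le> DIM('e)\<rbrakk> \<Longrightarrow>
       {x\<in>sphere 0 1. blinfun_apply f x = 1} \<subseteq>
         closure (convex hull {x\<in>sphere 0 1. k_smooth k x \<and> blinfun_apply f x = 1})"
proof -
  have "\<exists>a. (\<forall>y\<in>P. a \<bullet> y \<le> 1) \<and> F = {x\<in>P. a \<bullet> x = 1}" if "F facet_of P" for F
    using facet_supporting_vector[OF polytope_P zero_interior_P that] by blast
  then obtain v where v: "\<And>F y. \<lbrakk>F facet_of P; y \<in> P\<rbrakk> \<Longrightarrow> v F \<bullet> y \<le> 1"
      "\<And>F. F facet_of P \<Longrightarrow> F = {x\<in>P. v F \<bullet> x = 1}"
    by metis
  have memF: "x \<in> F \<longleftrightarrow> x \<in> P \<and> v F \<bullet> x = 1" if "F facet_of P" for F x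
    using v(2)[OF that] by blast
  have fr: "frontier P = \<Union>{F. F facet_of P}"
    using frontier_eq_Union_facets[OF polytope_P] zero_interior_P by blast
  define \<Phi> where "\<Phi> = (\<lambda>F. dual (v F)) ` {F. F facet_of P}"
  have slice: "{x\<in>sphere 0 1. dual (v F) x = 1} = h ` F" if F: "F facet_of P" for F
  proof
    have "F \<subseteq> frontier P"
      using F fr by blast
    then show "h ` F \<subseteq> {x\<in>sphere 0 1. dual (v F) x = 1}"
      using memF[OF F] by (auto simp: frontier_P)
    show "{x\<in>sphere 0 1. dual (v F) x = 1} \<subseteq> h ` F"
    proof clarsimp
      fix x assume x: "norm x = 1" "v F \<bullet> g x = 1"
      then have "g x \<in> F"
        using memF[OF F] by (simp add: mem_P)
      then show "x \<in> h ` F"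
        by (metis hg image_eqI)
    qed
  qed
  show thesis
  proof (rule that[of \<Phi>])
    show "finite \<Phi>"
      unfolding \<Phi>_def using finite_polytope_facets[OF polytope_P] by blast
    show "f x \<le> norm x" if "f \<in> \<Phi>" for f x
      using that v(1) dual_le_norm unfolding \<Phi>_def by auto
    have ex: "\<exists>f\<in>\<Phi>. f x = norm x" if "x \<noteq> 0" for x
    proof -
      have "g (x /\<^sub>R norm x) \<in> frontier P"
        using that by (simp add: frontier_P)
      then obtain F where F: "F facet_of P" "g (x /\<^sub>R norm x) \<in> F"
        using fr by blast
      then have "v F \<bullet> g (x /\<^sub>R norm x) = 1"
        using memF by blast
      then have "dual (v F) x = norm x"
        using that by (simp add: linear_scale[OF lin_g] field_simps)
      then show ?thesis
        using F(1) unfolding \<Phi>_def by blast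
    qed
    show "\<exists>f\<in>\<Phi>. f x = norm x" for x
    proof (cases "x = 0")
      \<comment> \<open>At the origin every functional will do, but one must exist: a non-zero
        vector supplies it.\<close>
      case True
      obtain z :: 'a where "z \<noteq> 0"
        using assms by auto
      then obtain f where "f \<in> \<Phi>"
        using ex by blast
      then show ?thesis
        using True by (intro bexI[of _ f]) (auto simp: blinfun.zero_right)
    qed (rule ex)
    show "{x\<in>sphere 0 1. f x = 1} \<subseteq> closure (U \<inter> {x\<in>sphere 0 1. f x = 1})"
      if f: "f \<in> \<Phi>" and U: "U \<subseteq> sphere 0 1" "sphere 0 1 \<subseteq> closure U" for f U
    proof -
      obtain F where F: "F facet_of P" "f = dual (v F)"
        using f unfolding \<Phi>_def by blast
      have "F \<subseteq> closure (g ` U \<inter> F)"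
      proof (rule facet_subset_closure_dense[OF polytope_P _ F(1)])
        show "g ` U \<subseteq> frontier P"
          using U(1) by (auto simp: frontier_P)
        have "g ` sphere 0 1 \<subseteq> g ` closure U"
          using U(2) by blast
        also have "\<dots> \<subseteq> closure (g ` U)"
          by (intro image_closure_subset cont_g closure_subset) auto
        finally show "frontier P \<subseteq> closure (g ` U)"
          by (force simp: frontier_P image_subset_iff)
      qed (use zero_interior_P in blast)
      then have "h ` F \<subseteq> h ` closure (g ` U \<inter> F)"
        by blast
      also have "\<dots> \<subseteq> closure (h ` (g ` U \<inter> F))"
        by (intro image_closure_subset cont_h closure_subset) auto
      also have "\<dots> \<subseteq> closure (U \<inter> h ` F)"
        by (intro closure_mono) auto
      finally show ?thesis
        unfolding F(2) slice[OF F(1)] .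
    qed
    show "{x\<in>sphere 0 1. f x = 1} \<subseteq> closure (convex hull {x\<in>sphere 0 1. k_smooth k x \<and> f x = 1})"
      if f: "f \<in> \<Phi>" and k: "1 \<le> k" "k \<le> DIM('e)" for f k
    proof -
      obtain F where F: "F facet_of P" "f = dual (v F)"
        using f unfolding \<Phi>_def by blast
      let ?D = "{x\<in>F. dim (supporting_vectors P x) = k}"
      have "F \<subseteq> closure (convex hull ?D)"
        by (rule facet_subset_closure_hull_k_smooth[OF polytope_P zero_interior_P F(1) k])
      then have "h ` F \<subseteq> h ` closure (convex hull ?D)"
        by blast
      also have "\<dots> \<subseteq> closure (h ` (convex hull ?D))"
        by (intro image_closure_subset cont_h closure_subset) auto
      also have "h ` (convex hull ?D) = convex hull (h ` ?D)"
        by (rule convex_hull_linear_image[OF lin_h])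
      also have "closure \<dots> \<subseteq> closure (convex hull {x\<in>sphere 0 1. k_smooth k x \<and> f x = 1})"
      proof (intro closure_mono hull_mono image_subsetI)
        fix x assume x: "x \<in> ?D"
        then have "h x \<in> sphere 0 1 \<and> dual (v F) (h x) = 1"
          using slice[OF F(1)] by blast
        then show "h x \<in> {x\<in>sphere 0 1. k_smooth k x \<and> f x = 1}"
          using k_smooth_iff[of x] F(2) x by auto
      qed
      finally show ?thesis
        using slice[OF F(1)] unfolding F(2) by simp
    qed
  qed
qed

end

section \<open>Constancy of the norm ratio\<close>

lemma preserves_bj_orth_lower_bound:
  assumes T: "linear T" "preserves_at bj_orth T x" and "norm x = 1"
    and f: "blinfun_apply f x = 1" "\<And>y. blinfun_apply f y \<le> norm y"
  shows "\<bar>blinfun_apply f y\<bar> * norm (T x) \<le> norm (T y)"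
proof (cases "blinfun_apply f y = 0")
  case False
  define w where "w = y - f y *\<^sub>R x"
  have fw: "f w = 0"
    by (simp add: w_def f blinfun.diff_right blinfun.scaleR_right)
  \<comment> \<open>Since \<open>f\<close> is 1 at \<open>x\<close> and vanishes at
    \<open>w\<close>, its value at every \<open>x + c w\<close> is 1, a lower bound for the norm
    there. So \<open>x\<close> is Birkhoff-James orthogonal to \<open>w\<close>.\<close>
  have "norm (x + c *\<^sub>R w) \<ge> norm x" for c
    using f(2)[of "x + c *\<^sub>R w"] by (simp add: assms(3) f fw blinfun.add_right blinfun.scaleR_right)
  then have "bj_orth (T x) (T w)"
    using T(2) by (simp add: preserves_at_def bj_orth_def)
  \<comment> \<open>The coefficient \<open>1 / f y\<close> is the one that makes the right-hand
    vector a multiple of \<open>T y\<close>.\<close>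
  then have le: "norm (T x) \<le> norm (T x + (1 / f y) *\<^sub>R T w)"
    unfolding bj_orth_def by blast
  have "T y = f y *\<^sub>R (T x + (1 / f y) *\<^sub>R T w)"
    using False by (simp add: w_def linear_diff[OF T(1)] linear_scale[OF T(1)] algebra_simps)
  then have "norm (T y) = \<bar>f y\<bar> * norm (T x + (1 / f y) *\<^sub>R T w)"
    by simp
  then show ?thesis
    using le by (simp add: mult_left_mono)
qed simp

lemma norm_constant_on_facet:
  assumes T: "linear T" "continuous_on UNIV T"
    and f: "\<And>y. blinfun_apply f y \<le> norm y"
    and S: "S = {x\<in>sphere 0 1. blinfun_apply f x = 1}"
    and D: "\<And>x. x \<in> D \<Longrightarrow> preserves_at bj_orth T x" "S \<subseteq> closure (convex hull (D \<inter> S))"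
  shows "\<exists>c. \<forall>y\<in>S. norm (T y) = c"
proof (cases "D \<inter> S = {}")
  \<comment> \<open>The hull of the empty set is empty, so \<open>S\<close> is empty and the claim
    is vacuous.\<close>
  case True
  then show ?thesis using D(2) by simp
next
  case False
  then obtain x where x: "x \<in> D" "x \<in> S" by blast
  let ?K = "{y. norm (T y) \<le> norm (T x)}"
  have ge: "norm (T z) \<le> norm (T y)" if "z \<in> D" "z \<in> S" "y \<in> S" for y z
    using preserves_bj_orth_lower_bound[OF T(1) D(1)[OF that(1)] _ _ f, of y] that by (simp add: S)
  have "closed ?K"
    using T(2) by (intro closed_Collect_le continuous_intros)
  moreover have "convex ?K"
  proof -
    have "?K = T -` cball 0 (norm (T x))" by auto
    then show ?thesis
      using convex_linear_vimage[OF T(1)] by simp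
  qed
  moreover have "D \<inter> S \<subseteq> ?K"
    using ge x by blast
  ultimately have "closure (convex hull (D \<inter> S)) \<subseteq> ?K"
    by (intro closure_minimal hull_minimal)
  then show ?thesis
    using D(2) ge x by (intro exI[of _ "norm (T x)"]) (blast intro: antisym)
qed

lemma scalar_mult_isometry_of_dense_in_facets:
  fixes \<Phi> :: "('a::real_normed_vector \<Rightarrow>\<^sub>L real) set"
  assumes \<Phi>: "finite \<Phi>" "\<And>f x. f \<in> \<Phi> \<Longrightarrow> blinfun_apply f x \<le> norm x"
      "\<And>x. \<exists>f\<in>\<Phi>. blinfun_apply f x = norm x"
    and T: "linear T" "continuous_on UNIV T"
    and D: "\<And>x. x \<in> D \<Longrightarrow> preserves_at bj_orth T x"
      "\<And>f. f \<in> \<Phi> \<Longrightarrow> {x\<in>sphere 0 1. blinfun_apply f x = 1}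
        \<subseteq> closure (convex hull (D \<inter> {x\<in>sphere 0 1. blinfun_apply f x = 1}))"
  shows "scalar_mult_isometry T"
proof (cases "\<exists>z::'a. z \<noteq> 0")
  case True
  then obtain z :: 'a where z: "z \<noteq> 0" by blast
  define r where "r y = norm (T y) / norm y" for y
  have "\<exists>c. \<forall>y\<in>{x\<in>sphere 0 1. blinfun_apply f x = 1}. norm (T y) = c" if "f \<in> \<Phi>" for f
    by (rule norm_constant_on_facet[OF T \<Phi>(2)[OF that] refl D(1) D(2)[OF that]])
  then obtain c where c: "\<And>f y. \<lbrakk>f \<in> \<Phi>; norm y = 1; f y = 1\<rbrakk> \<Longrightarrow> norm (T y) = c f"
    by simp metis
  have scale: "r (k *\<^sub>R y) = r y" if "k \<noteq> 0" for k y
    using that by (simp add: r_def linear_scale[OF T(1)])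
  \<comment> \<open>Every non-zero vector normalizes to a point of one of the finitely many slices,
    and \<open>r\<close> is invariant under scaling.\<close>
  have r_mem: "r y \<in> c ` \<Phi>" if "y \<noteq> 0" for y
  proof -
    obtain f where f: "f \<in> \<Phi>" "f y = norm y"
      using \<Phi>(3) by blast
    have "norm (T (y /\<^sub>R norm y)) = c f"
      using that f by (intro c) (auto simp: blinfun.scaleR_right)
    moreover have "norm (T (y /\<^sub>R norm y)) = r (y /\<^sub>R norm y)"
      using that by (simp add: r_def)
    ultimately have "r y = c f"
      using scale[of "inverse (norm y)" y] that by simp
    then show ?thesis
      using f(1) by blast
  qed
  have "r y = r z" if y: "y \<noteq> 0" for y
  proof (cases "0 \<in> closed_segment z y")
    case True
    then obtain u where u: "(1 - u) *\<^sub>R z + u *\<^sub>R y = 0"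
      by (force simp: closed_segment_def)
    then have "u \<noteq> 0" "u \<noteq> 1"
      using z y by auto
    have "u *\<^sub>R y = - ((1 - u) *\<^sub>R z)"
      using u by (simp add: eq_neg_iff_add_eq_0 add.commute)
    then have "u *\<^sub>R y = (u - 1) *\<^sub>R z"
      by (simp add: algebra_simps)
    then show ?thesis
      using scale[of u y] scale[of "u - 1" z] \<open>u \<noteq> 0\<close> \<open>u \<noteq> 1\<close> by simp
  next
    case False
    have "continuous_on (closed_segment z y) r"
      unfolding r_def using False
      by (intro continuous_intros continuous_on_subset[OF T(2)]) auto
    moreover have "finite (r ` closed_segment z y)"
    proof (rule finite_subset)
      show "r ` closed_segment z y \<subseteq> c ` \<Phi>"
        using False by (intro image_subsetI r_mem) metis
    qed (simp add: \<Phi>(1))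
    ultimately have "r constant_on closed_segment z y"
      by (intro continuous_finite_range_constant connected_segment)
    then show ?thesis
      by (auto simp: constant_on_def)
  qed
  then have "norm (T y) = r z * norm y" for y
    by (cases "y = 0") (auto simp: r_def linear_0[OF T(1)] field_simps)
  moreover have "r z \<ge> 0"
    by (simp add: r_def)
  ultimately show ?thesis
    unfolding scalar_mult_isometry_def by blast
next
  case False
  then have "norm (T x) = 0 * norm x" for x
    by (metis linear_0[OF T(1)] norm_zero mult_zero_left)
  then show ?thesis
    unfolding scalar_mult_isometry_def by blast
qed

section \<open>Norm derivatives\<close>

text \<open>Convexity of the norm, applied to \<open>u + s v\<close> as a convex combination of
  \<open>u\<close> and \<open>u + t v\<close>.\<close>

lemma norm_slope_mono:
  fixes u v :: "'a::real_normed_vector"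
  assumes "0 < s" "s \<le> t"
  shows "(norm (u + s *\<^sub>R v) - norm u) / s \<le> (norm (u + t *\<^sub>R v) - norm u) / t"
proof -
  have "u + s *\<^sub>R v = (1 - s/t) *\<^sub>R u + (s/t) *\<^sub>R (u + t *\<^sub>R v)"
    using assms by (simp add: algebra_simps)
  then have "norm (u + s *\<^sub>R v) \<le> norm ((1 - s/t) *\<^sub>R u) + norm ((s/t) *\<^sub>R (u + t *\<^sub>R v))"
    by (metis norm_triangle_ineq)
  also have "\<dots> = (1 - s/t) * norm u + (s/t) * norm (u + t *\<^sub>R v)"
    using assms by simp
  finally show ?thesis
    using assms by (simp add: field_simps)
qed

text \<open>The difference quotient is monotone and bounded below by \<open>- norm v\<close>, so it
  converges to its infimum. This gives the \<open>Lim\<close> in \<open>rho_plus\<close> its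
  intended meaning.\<close>

lemma right_norm_derivative:
  fixes u v :: "'a::real_normed_vector"
  obtains L where "((\<lambda>t. (norm (u + t *\<^sub>R v) - norm u) / t) \<longlongrightarrow> L) (at_right 0)"
    "\<And>t. t > 0 \<Longrightarrow> L \<le> (norm (u + t *\<^sub>R v) - norm u) / t"
proof -
  define q where "q t = (norm (u + t *\<^sub>R v) - norm u) / t" for t
  have "- norm v \<le> q t" if "t > 0" for t
    using norm_triangle_ineq4[of "u + t *\<^sub>R v" "t *\<^sub>R v"] that by (simp add: q_def field_simps)
  then have bdd: "bdd_below (q ` {0<..})"
    by (auto intro!: bdd_belowI)
  define L where "L = Inf (q ` {0<..})"
  have L: "L \<le> q t" if "t > 0" for t
    unfolding L_def using bdd that by (intro cInf_lower) auto
  have "(q \<longlongrightarrow> L) (at_right 0)"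
  proof (rule order_tendstoI)
    fix a assume "a < L"
    then show "\<forall>\<^sub>F t in at_right 0. a < q t"
      using L by (auto intro!: eventually_mono[OF eventually_at_right_less[of 0]] intro: less_le_trans)
  next
    fix a assume "L < a"
    then obtain t where t: "t > 0" "q t < a"
      unfolding L_def using cInf_less_iff[OF _ bdd] by auto
    have "q s < a" if "s > 0" "s < t" for s
      using norm_slope_mono[of s t u v] that t(2) by (simp add: q_def)
    then show "\<forall>\<^sub>F s in at_right 0. q s < a"
      using t(1) by (auto simp: eventually_at_right_field)
  qed
  then show thesis
    using that L unfolding q_def by blast
qed

lemma rho_plus_eqI:
  assumes "((\<lambda>t. (norm (u + t *\<^sub>R v) - norm u) / t) \<longlongrightarrow> L) (at_right 0)"
  shows "rho_plus u v = norm u * L"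
  unfolding rho_plus_def using tendsto_Lim[OF _ assms] by simp

text \<open>The substitution of \<open>- t\<close> for \<open>t\<close> turns left limits into right
  limits, so one-sided facts have to be proved for \<open>rho_plus\<close> only.\<close>

lemma rho_minus_eq: "rho_minus u v = - rho_plus u (- v)"
proof -
  obtain L where L: "((\<lambda>t. (norm (u + t *\<^sub>R - v) - norm u) / t) \<longlongrightarrow> L) (at_right 0)"
    using right_norm_derivative .
  then have "((\<lambda>t. - ((norm (u + t *\<^sub>R - v) - norm u) / t)) \<longlongrightarrow> - L) (at_right 0)"
    by (rule tendsto_minus)
  then have "((\<lambda>t. (norm (u + t *\<^sub>R v) - norm u) / t) \<longlongrightarrow> - L) (at_left 0)"
    unfolding filterlim_at_left_to_right[of _ _ 0] by simp
  then have "rho_minus u v = norm u * (- L)"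
    unfolding rho_minus_def by (subst tendsto_Lim) auto
  then show ?thesis
    using rho_plus_eqI[OF L] by simp
qed

lemma rho_plus_le:
  assumes "t > 0"
  shows "t * rho_plus u v \<le> norm u * (norm (u + t *\<^sub>R v) - norm u)"
proof -
  obtain L where L: "((\<lambda>t. (norm (u + t *\<^sub>R v) - norm u) / t) \<longlongrightarrow> L) (at_right 0)"
    "\<And>t. t > 0 \<Longrightarrow> L \<le> (norm (u + t *\<^sub>R v) - norm u) / t"
    by (rule right_norm_derivative[of u v]) blast
  have "t * L \<le> norm (u + t *\<^sub>R v) - norm u"
    using L(2)[OF assms] assms by (simp add: field_simps)
  then have "norm u * (t * L) \<le> norm u * (norm (u + t *\<^sub>R v) - norm u)"
    by (intro mult_left_mono) auto
  then show ?thesis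
    using rho_plus_eqI[OF L(1)] by (simp add: mult.left_commute)
qed

text \<open>By the triangle inequality for \<open>2 u\<close>, the quotients in the directions
  \<open>v\<close> and \<open>- v\<close> have a non-negative sum.\<close>

lemma rho_minus_le_rho_plus: "rho_minus u v \<le> rho_plus u v"
proof -
  obtain L where L: "((\<lambda>t. (norm (u + t *\<^sub>R v) - norm u) / t) \<longlongrightarrow> L) (at_right 0)"
    using right_norm_derivative .
  obtain M where M: "((\<lambda>t. (norm (u + t *\<^sub>R - v) - norm u) / t) \<longlongrightarrow> M) (at_right 0)"
    using right_norm_derivative .
  have "0 \<le> (norm (u + t *\<^sub>R v) - norm u) / t + (norm (u + t *\<^sub>R - v) - norm u) / t" if "t > 0" for t
  proof -
    have "norm (2 *\<^sub>R u) \<le> norm (u + t *\<^sub>R v) + norm (u + t *\<^sub>R - v)"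
      using norm_triangle_ineq[of "u + t *\<^sub>R v" "u + t *\<^sub>R - v"] by (simp add: scaleR_2)
    then show ?thesis
      using that by (simp flip: add_divide_distrib)
  qed
  then have "0 \<le> L + M"
    by (intro tendsto_lowerbound[OF tendsto_add[OF L M]] eventually_mono[OF eventually_at_right_less[of 0]]) auto
  then have "0 \<le> norm u * (L + M)"
    by simp
  then show ?thesis
    using rho_plus_eqI[OF L] rho_plus_eqI[OF M] rho_minus_eq[of u v] by (simp add: algebra_simps)
qed

text \<open>The norm is convex along the line through \<open>u\<close> in direction
  \<open>v\<close>, so these signs of the one-sided derivatives put its minimum at \<open>u\<close>.
  Inequalities suffice, which lets one lemma serve all three kinds of norm-derivative orthogonality.
  The case \<open>u = 0\<close> matters because \<open>T x\<close> may vanish.\<close>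

lemma bj_orth_of_rho:
  assumes "rho_minus u v \<le> 0" "0 \<le> rho_plus u v"
  shows "bj_orth u v"
proof (cases "u = 0")
  case False
  have *: "norm u \<le> norm (u + t *\<^sub>R w)" if "t > 0" "0 \<le> rho_plus u w" for t w
  proof -
    have "0 \<le> norm u * (norm (u + t *\<^sub>R w) - norm u)"
      using rho_plus_le[OF that(1), of u w] that by (smt (verit) mult_nonneg_nonneg)
    then show ?thesis
      using False by (simp add: zero_le_mult_iff)
  qed
  show ?thesis
    unfolding bj_orth_def
  proof
    fix c :: real
    consider "c = 0" | "c > 0" | "- c > 0" by linarith
    then show "norm u \<le> norm (u + c *\<^sub>R v)"
      using *[of c v] *[of "- c" "- v"] assms rho_minus_eq[of u v] by cases auto
  qed
qed (simp add: bj_orth_def)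

text \<open>At a smooth point only one \<open>f\<close> in the finite set attains the norm, so the
  norm equals \<open>f\<close> near \<open>x\<close> along the line. A minimum at \<open>x\<close>
  then forces \<open>f w = 0\<close>.\<close>

lemma rho_eq_0_at_smooth_point:
  fixes \<Phi> :: "('a::real_normed_vector \<Rightarrow>\<^sub>L real) set"
  assumes \<Phi>: "finite \<Phi>" "\<And>f x. f \<in> \<Phi> \<Longrightarrow> blinfun_apply f x \<le> norm x"
      "\<And>x. \<exists>f\<in>\<Phi>. blinfun_apply f x = norm x"
    and x: "norm (x::'a) = 1" "smooth_pt x" and w: "bj_orth x w"
  shows "rho_plus x w = 0" "rho_minus x w = 0"
proof -
  have supp: "f \<in> supp_funcs x" if "f \<in> \<Phi>" "f x = 1" for f
  proof -
    have "\<bar>f y\<bar> \<le> norm y" for y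
      using \<Phi>(2)[OF that(1), of y] \<Phi>(2)[OF that(1), of "- y"] by (simp add: blinfun.minus_right)
    then have "norm f \<le> 1"
      by (intro norm_blinfun_bound) auto
    moreover have "norm f \<ge> 1"
      using norm_blinfun[of f x] that x by simp
    ultimately show ?thesis
      using that x by (simp add: supp_funcs_def)
  qed
  obtain f where f: "f \<in> \<Phi>" "f x = 1"
    using \<Phi>(3)[of x] x by auto
  have less: "g x < 1" if g: "g \<in> \<Phi>" "g \<noteq> f" for g
  proof (rule ccontr)
    assume "\<not> g x < 1"
    then have gx: "g x = 1"
      using \<Phi>(2)[OF g(1), of x] x by simp
    \<comment> \<open>J(x) spans a line, so \<open>f\<close> and \<open>g\<close> are multiples of
      one functional \<open>b\<close>; since both are 1 at \<open>x\<close>, they coincide.\<close>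
    obtain B where B: "B \<subseteq> span (supp_funcs x)" "independent B" "span (supp_funcs x) \<subseteq> span B"
        "card B = dim (span (supp_funcs x))"
      by (rule real_vector.basis_exists)
    then have "card B = 1"
      using x(2) unfolding k_smooth_def by simp
    then obtain b where "B = {b}"
      by (rule card_1_singletonE)
    then have "f \<in> span {b}" "g \<in> span {b}"
      using supp[OF f] supp[OF g(1) gx] B(3) span_base by blast+
    then obtain i j where "f = i *\<^sub>R b" "g = j *\<^sub>R b"
      by (auto simp: span_singleton)
    then have "i * b x = 1" "j * b x = 1"
      using f(2) gx by (auto simp: blinfun.scaleR_left)
    then have "i = j"
      by (metis mult_cancel_right zero_neq_one mult_zero_right)
    then show False
      using g(2) \<open>f = _\<close> \<open>g = _\<close> by simp
  qed
  have ev: "\<forall>\<^sub>F t in at 0. norm (x + t *\<^sub>R w) = 1 + t * f w"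
  proof -
    have "\<forall>\<^sub>F t in at 0. g (x + t *\<^sub>R w) < f (x + t *\<^sub>R w)" if g: "g \<in> \<Phi> - {f}" for g
    proof -
      have "((\<lambda>t. f (x + t *\<^sub>R w) - g (x + t *\<^sub>R w)) \<longlongrightarrow> f (x + 0 *\<^sub>R w) - g (x + 0 *\<^sub>R w)) (at 0)"
        by (intro tendsto_intros)
      moreover have "f (x + 0 *\<^sub>R w) - g (x + 0 *\<^sub>R w) > 0"
        using less[of g] g f by simp
      ultimately have "\<forall>\<^sub>F t in at 0. f (x + t *\<^sub>R w) - g (x + t *\<^sub>R w) > 0"
        by (rule order_tendstoD(1))
      then show ?thesis
        by eventually_elim simp
    qed
    then have "\<forall>\<^sub>F t in at 0. \<forall>g\<in>\<Phi> - {f}. g (x + t *\<^sub>R w) < f (x + t *\<^sub>R w)"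
      using \<Phi>(1) by (intro eventually_ball_finite) auto
    then show ?thesis
    proof eventually_elim
      case (elim t)
      obtain g where g: "g \<in> \<Phi>" "g (x + t *\<^sub>R w) = norm (x + t *\<^sub>R w)"
        using \<Phi>(3) by blast
      have "g = f"
        using elim g \<Phi>(2)[OF f(1), of "x + t *\<^sub>R w"] by (metis Diff_iff not_less singletonD)
      then show ?case
        using g f(2) by (simp add: blinfun.add_right blinfun.scaleR_right)
    qed
  qed
  \<comment> \<open>Orthogonality says \<open>1 + t * f w\<close> is at least 1 for small
    \<open>t\<close> of either sign.\<close>
  have "\<forall>\<^sub>F t in at_right 0. t * f w \<ge> 0" "\<forall>\<^sub>F t in at_left 0. t * f w \<ge> 0"
    using ev w x(1) unfolding eventually_at_split bj_orth_def
    by (auto elim!: eventually_mono) (smt (verit))+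
  then have "\<forall>\<^sub>F t in at_right 0. t * f w \<ge> 0 \<and> t > 0" "\<forall>\<^sub>F t in at_left 0. t * f w \<ge> 0 \<and> t < 0"
    by (simp_all add: eventually_conj_iff eventually_at_right_less) (simp add: eventually_at_filter)
  from this[THEN eventually_happens'[rotated]] obtain s t
    where "s * f w \<ge> 0 \<and> s > 0" "t * f w \<ge> 0 \<and> t < 0"
    by auto
  then have "f w = 0"
    by (auto simp: zero_le_mult_iff)
  have "\<forall>\<^sub>F t in at 0. (norm (x + t *\<^sub>R w) - norm x) / t = 0"
    using ev by eventually_elim (simp add: x \<open>f w = 0\<close>)
  then have "((\<lambda>t. (norm (x + t *\<^sub>R w) - norm x) / t) \<longlongrightarrow> 0) (at 0)"
    by (rule tendsto_eventually)
  then have "((\<lambda>t. (norm (x + t *\<^sub>R w) - norm x) / t) \<longlongrightarrow> 0) (at_right 0)"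
    "((\<lambda>t. (norm (x + t *\<^sub>R w) - norm x) / t) \<longlongrightarrow> 0) (at_left 0)"
    unfolding filterlim_at_split by auto
  then have "Lim (at_right 0) (\<lambda>t. (norm (x + t *\<^sub>R w) - norm x) / t) = 0"
    "Lim (at_left 0) (\<lambda>t. (norm (x + t *\<^sub>R w) - norm x) / t) = 0"
    by (auto intro!: tendsto_Lim)
  then show "rho_plus x w = 0" "rho_minus x w = 0"
    by (simp_all add: rho_plus_def rho_minus_def)
qed

section \<open>Scalar multiples of isometries preserve every orthogonality\<close>

lemma rho_plus_scalar_mult_isometry:
  assumes T: "linear T" "\<And>x. norm (T x) = c * norm x"
  shows "rho_plus (T u) (T v) = c\<^sup>2 * rho_plus u v"
proof -
  obtain L where L: "((\<lambda>t. (norm (u + t *\<^sub>R v) - norm u) / t) \<longlongrightarrow> L) (at_right 0)"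
    using right_norm_derivative .
  have "norm (T u + t *\<^sub>R T v) = c * norm (u + t *\<^sub>R v)" for t
    using T(2)[of "u + t *\<^sub>R v"] by (simp add: linear_add[OF T(1)] linear_scale[OF T(1)])
  then have "(norm (T u + t *\<^sub>R T v) - norm (T u)) / t = c * ((norm (u + t *\<^sub>R v) - norm u) / t)" for t
    by (simp add: T(2) algebra_simps)
  then have "((\<lambda>t. (norm (T u + t *\<^sub>R T v) - norm (T u)) / t) \<longlongrightarrow> c * L) (at_right 0)"
    using tendsto_mult_left[OF L, of c] by presburger
  \<comment> \<open>One factor \<open>c\<close> comes from \<open>norm (T u)\<close>, the other from
    the difference quotient.\<close>
  from rho_plus_eqI[OF this] show ?thesis
    using rho_plus_eqI[OF L] by (simp add: T(2) power2_eq_square)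
qed

lemma scalar_mult_isometry_preserves:
  assumes T: "linear T" "scalar_mult_isometry T"
  shows "preserves_at bj_orth T x" "preserves_at rho_orth T x"
    "preserves_at rho_plus_orth T x" "preserves_at rho_minus_orth T x"
proof -
  obtain c where c: "c \<ge> 0" "\<And>x. norm (T x) = c * norm x"
    using T(2) unfolding scalar_mult_isometry_def by blast
  have plus: "rho_plus (T x) (T w) = c\<^sup>2 * rho_plus x w" for w
    by (rule rho_plus_scalar_mult_isometry[OF T(1) c(2)])
  have minus: "rho_minus (T x) (T w) = c\<^sup>2 * rho_minus x w" for w
    using plus[of "- w"] by (simp add: rho_minus_eq linear_neg[OF T(1)])
  show "preserves_at rho_plus_orth T x" "preserves_at rho_minus_orth T x" "preserves_at rho_orth T x"
    unfolding preserves_at_def rho_plus_orth_def rho_minus_orth_def rho_orth_def rho_def plus minus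
    by (auto simp flip: distrib_left)
  have "norm (T x + t *\<^sub>R T w) = c * norm (x + t *\<^sub>R w)" for t w
    using c(2)[of "x + t *\<^sub>R w"] by (simp add: linear_add[OF T(1)] linear_scale[OF T(1)])
  then show "preserves_at bj_orth T x"
    unfolding preserves_at_def bj_orth_def by (simp add: c mult_left_mono)
qed

section \<open>The equivalence of the six conditions\<close>

theorem mainTheorem20:
  fixes T :: "'a::real_normed_vector \<Rightarrow> 'a"
  assumes "fin_dim_space TYPE('a)"
    and "polyhedral_space TYPE('a)"
    and "(UNIV::'a set) \<noteq> {0}"
    and "linear T"
  shows
   "((\<exists>k. 1 \<le> k \<and> k \<le> dim (UNIV::'a set) \<and>
        (\<forall>x\<in>sphere 0 1. k_smooth k x \<longrightarrow> preserves_at bj_orth T x))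
     \<longleftrightarrow> (\<exists>U. U \<subseteq> sphere 0 1 \<and> sphere 0 1 \<subseteq> closure U \<and>
        (\<forall>x\<in>U. preserves_at bj_orth T x)))
  \<and> ((\<exists>U. U \<subseteq> sphere 0 1 \<and> sphere 0 1 \<subseteq> closure U \<and>
        (\<forall>x\<in>U. preserves_at bj_orth T x))
     \<longleftrightarrow> (\<forall>x\<in>sphere 0 1. smooth_pt x \<longrightarrow> preserves_at rho_orth T x))
  \<and> ((\<forall>x\<in>sphere 0 1. smooth_pt x \<longrightarrow> preserves_at rho_orth T x)
     \<longleftrightarrow> (\<forall>x\<in>sphere 0 1. smooth_pt x \<longrightarrow> preserves_at rho_plus_orth T x))
  \<and> ((\<forall>x\<in>sphere 0 1. smooth_pt x \<longrightarrow> preserves_at rho_plus_orth T x)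
     \<longleftrightarrow> (\<forall>x\<in>sphere 0 1. smooth_pt x \<longrightarrow> preserves_at rho_minus_orth T x))
  \<and> ((\<forall>x\<in>sphere 0 1. smooth_pt x \<longrightarrow> preserves_at rho_minus_orth T x)
     \<longleftrightarrow> scalar_mult_isometry T)"
  (is "(?i \<longleftrightarrow> ?ii) \<and> (?ii \<longleftrightarrow> ?iii) \<and> (?iii \<longleftrightarrow> ?iv) \<and> (?iv \<longleftrightarrow> ?v) \<and> (?v \<longleftrightarrow> ?vi)")
proof -
  obtain h :: "real ^ 'a dim_index \<Rightarrow> 'a" and g where hg: "bounded_linear h" "bounded_linear g"
      "\<And>x. g (h x) = x" "\<And>y. h (g y) = y" and dim: "DIM(real ^ 'a dim_index) = dim (UNIV :: 'a set)"
    using finite_dimensional_euclidean_coordinates[OF assms(1,3)] by blast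
  interpret unit_ball_coordinates h g
    by (rule unit_ball_coordinates.intro) (use hg assms(2) in auto)
  have dim_ge_1: "1 \<le> dim (UNIV :: 'a set)"
    unfolding dim[symmetric] using DIM_positive[where 'a = "real ^ 'a dim_index"] by linarith
  obtain \<Phi> :: "('a \<Rightarrow>\<^sub>L real) set" where \<Phi>:
    "finite \<Phi>"
    "\<And>f x. f \<in> \<Phi> \<Longrightarrow> blinfun_apply f x \<le> norm x"
    "\<And>x. \<exists>f\<in>\<Phi>. blinfun_apply f x = norm x"
    and dense: "\<And>f U. \<lbrakk>f \<in> \<Phi>; U \<subseteq> sphere 0 1; sphere 0 1 \<subseteq> closure U\<rbrakk> \<Longrightarrow>
       {x\<in>sphere 0 1. blinfun_apply f x = 1} \<subseteq> closure (U \<inter> {x\<in>sphere 0 1. blinfun_apply f x = 1})"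
    and k_smooth_dense: "\<And>f k. \<lbrakk>f \<in> \<Phi>; 1 \<le> k; k \<le> dim (UNIV :: 'a set)\<rbrakk> \<Longrightarrow>
       {x\<in>sphere 0 1. blinfun_apply f x = 1} \<subseteq>
         closure (convex hull {x\<in>sphere 0 1. k_smooth k x \<and> blinfun_apply f x = 1})"
    by (rule norming_functionals[OF assms(3), unfolded dim]) blast
  \<comment> \<open>Factor \<open>T\<close> as \<open>(T \<circ> h) \<circ> g\<close>: the first
    factor is linear on a Euclidean space, hence bounded, and \<open>g\<close> is
    continuous.\<close>
  have contT: "continuous_on UNIV T"
  proof -
    have "linear (T \<circ> h)"
      by (intro linear_compose lin_h assms(4))
    then have "bounded_linear (T \<circ> h)"
      by (simp add: linear_conv_bounded_linear)
    then have "continuous_on UNIV ((T \<circ> h) \<circ> g)"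
      by (intro continuous_on_compose cont_g linear_continuous_on)
    then show ?thesis
      by (simp add: o_def hg)
  qed
  have isometryI: ?vi
    if "\<And>x. x \<in> D \<Longrightarrow> preserves_at bj_orth T x"
      "\<And>f. f \<in> \<Phi> \<Longrightarrow> {x\<in>sphere 0 1. blinfun_apply f x = 1}
        \<subseteq> closure (convex hull (D \<inter> {x\<in>sphere 0 1. blinfun_apply f x = 1}))" for D
    by (rule scalar_mult_isometry_of_dense_in_facets[where \<Phi> = \<Phi> and D = D])
      (fact \<Phi> assms(4) contT that)+
  have i_vi: ?vi if i: ?i
  proof -
    obtain k where k: "1 \<le> k" "k \<le> dim (UNIV::'a set)"
        "\<And>x. x \<in> sphere 0 1 \<Longrightarrow> k_smooth k x \<Longrightarrow> preserves_at bj_orth T x"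
      using i by blast
    let ?D = "{x\<in>sphere 0 1. k_smooth k x}"
    show ?thesis
    proof (rule isometryI[of ?D])
      show "preserves_at bj_orth T x" if "x \<in> ?D" for x
        using k(3) that by blast
      fix f assume f: "f \<in> \<Phi>"
      have "?D \<inter> {x\<in>sphere 0 1. f x = 1} = {x\<in>sphere 0 1. k_smooth k x \<and> f x = 1}"
        by blast
      then show "{x\<in>sphere 0 1. f x = 1} \<subseteq> closure (convex hull (?D \<inter> {x\<in>sphere 0 1. f x = 1}))"
        using k_smooth_dense[OF f k(1,2)] by simp
    qed
  qed
  have ii_vi: ?vi if ii: ?ii
  proof -
    obtain U where U: "U \<subseteq> sphere 0 1" "sphere 0 1 \<subseteq> closure U"
        "\<And>x. x \<in> U \<Longrightarrow> preserves_at bj_orth T x"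
      using ii by blast
    show ?thesis
    proof (rule isometryI[of U])
      fix f assume "f \<in> \<Phi>"
      from dense[OF this U(1,2)]
      show "{x\<in>sphere 0 1. f x = 1} \<subseteq> closure (convex hull (U \<inter> {x\<in>sphere 0 1. f x = 1}))"
        by (rule subset_trans[OF _ closure_mono[OF hull_subset]])
    qed (fact U(3))
  qed
  have vi_ii: ?ii if ?vi
    by (rule exI[of _ "sphere 0 1"])
      (use scalar_mult_isometry_preserves(1)[OF assms(4) that] closure_subset in blast)
  \<comment> \<open>Common route from (iii), (iv) and (v). If \<open>x\<close> is smooth and
    Birkhoff-James orthogonal to \<open>w\<close>, both one-sided derivatives vanish; the sign
    condition at \<open>T x\<close> then gives Birkhoff-James orthogonality of the images, which is
    (i) with \<open>k = 1\<close>.\<close>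
  have smooth_vi: ?vi
    if rho: "\<And>x w. \<lbrakk>norm x = 1; smooth_pt x; rho_plus x w = 0; rho_minus x w = 0\<rbrakk> \<Longrightarrow>
          rho_minus (T x) (T w) \<le> 0 \<and> 0 \<le> rho_plus (T x) (T w)"
  proof -
    have "bj_orth (T x) (T w)" if "norm x = 1" "smooth_pt x" "bj_orth x w" for x w :: 'a
      using rho[OF that(1,2) rho_eq_0_at_smooth_point[OF \<Phi> that]] bj_orth_of_rho by blast
    then show ?thesis
      using dim_ge_1 by (intro i_vi exI[of _ 1]) (auto simp: preserves_at_def)
  qed
  have iii_vi: ?vi if ?iii
  proof (rule smooth_vi)
    fix x w :: 'a assume "norm x = 1" "smooth_pt x" "rho_plus x w = 0" "rho_minus x w = 0"
    then have "rho (T x) (T w) = 0"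
      using that by (auto simp: preserves_at_def rho_orth_def rho_def)
    then show "rho_minus (T x) (T w) \<le> 0 \<and> 0 \<le> rho_plus (T x) (T w)"
      using rho_minus_le_rho_plus[of "T x" "T w"] by (simp add: rho_def)
  qed
  have iv_vi: ?vi if ?iv
  proof (rule smooth_vi)
    fix x w :: 'a assume "norm x = 1" "smooth_pt x" "rho_plus x w = 0" "rho_minus x w = 0"
    then have "rho_plus (T x) (T w) = 0"
      using that by (auto simp: preserves_at_def rho_plus_orth_def)
    then show "rho_minus (T x) (T w) \<le> 0 \<and> 0 \<le> rho_plus (T x) (T w)"
      using rho_minus_le_rho_plus[of "T x" "T w"] by simp
  qed
  have v_vi: ?vi if ?v
  proof (rule smooth_vi)
    fix x w :: 'a assume "norm x = 1" "smooth_pt x" "rho_plus x w = 0" "rho_minus x w = 0"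
    then have "rho_minus (T x) (T w) = 0"
      using that by (auto simp: preserves_at_def rho_minus_orth_def)
    then show "rho_minus (T x) (T w) \<le> 0 \<and> 0 \<le> rho_plus (T x) (T w)"
      using rho_minus_le_rho_plus[of "T x" "T w"] by simp
  qed
  have vi_i: ?i if ?vi
    using scalar_mult_isometry_preserves(1)[OF assms(4) that] dim_ge_1 by blast
  have vi_iii: ?iii and vi_iv: ?iv and vi_v: ?v if ?vi
    using scalar_mult_isometry_preserves(2-4)[OF assms(4) that] by blast+
  show ?thesis
    using i_vi ii_vi iii_vi iv_vi v_vi vi_i vi_ii vi_iii vi_iv vi_v by argo
qed

end
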